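(* Let $f$ be $\omega$-regularly smooth on $D$ with some $h$ (where $\omega\in\mathcal N$, $h\in[0,h(f)]$), and let $g$ satisfy $$\|g(x'')-g(x')\|\le \psi(t)\|x''-x'\|\qquad \forall\, x',x''\in\overline{B(x_0,t)}\subseteq D,$$ where $\psi$ is a nondecreasing nonnegative function of a nonnegative argument. Suppose that the function $$W(t)=a-\Omega(\chi)+\Omega(\chi-t)-th+\Psi(t),\qquad t\in[0,\chi],$$ has a unique zero $t_\ast$ in the interval $[0,\chi]$, that the closed ball $\overline{B(x_0,t_\ast)}$ is contained in $D$, and that $$a<\Omega(\chi)+h\chi-\Psi(\chi).$$ Then: 1) the equation $f(x)+g(x)=0$ has a unique root $x_\ast$ in the ball $\overline{B(x_0,t_\ast)}$; 2) the successive approximations $$x_{n+1}=x_n-[f'(x_n)]^{-1}(f(x_n)+g(x_n))\qquad(n=0,1,\ldots),$$ starting from the given $x_0$, are defined for all $n=0,1,\ldots$, belong to $\overline{B(x_0,t_\ast)}$ and converge to $x_\ast$; 3) for all $n=0,1,\ldots$ the inequalities $$\|x_{n+1}-x_n\|\le t_{n+1}-t_n,\qquad \|x_\ast-x_n\|\le t_\ast-t_n$$ hold, where the sequence $\{t_n\}$, defined by $t_0=0$ and $$t_{n+1}=t_n+\frac{a-\Omega(\chi)+\Omega(\chi-t_n)-t_nh+\Psi(t_n)}{h+\omega(\chi-t_n)}\qquad(n=0,1,\ldots),$$ monotonically increases and converges to $t_\ast$.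
   Context: $X$ and $Y$ are Banach spaces, $D$ is a convex subset of $X$, $x_0\in D$ is a given point, and $f,g:D\to Y$ are nonlinear operators; $f$ is differentiable at every interior point of $D$ with derivative $f'(x)$ a bounded linear operator, and $g$ is not assumed differentiable. The definition of regular smoothness below uses $f'(x)$ for all $x\in D$ and tacitly presupposes that it exists there. Standing normalization: $f'(x_0)=I$ (the identity operator, so $Y=X$). $\overline{B(x_0,t)}$ is the closed ball with center $x_0$ and radius $t$. The displayed condition on $g$ is required for every $t\ge 0$ with $\overline{B(x_0,t)}\subseteq D$. $\mathcal N$ is the class of continuous, strictly increasing, concave functions $\omega:[0,\infty)\to[0,\infty)$ with $\omega(0)=0$. Put $h(f)=\inf_{x\in D}\|f'(x)\|$. For $\omega\in\mathcal N$, $f$ is called $\omega$-regularly smooth on $D$ (with some $h$) if there exists $h\in[0,h(f)]$ such that for all $x',x''\in D$ $$\omega^{-1}\bigl(h_f(x',x'')+\|f'(x'')-f'(x')\|\bigr)-\omega^{-1}\bigl(h_f(x',x'')\bigr)\le\|x''-x'\|,$$ where $h_f(x',x'')=\min\{\|f'(x')\|,\|f'(x'')\|\}-h$ (it is implicit that the values of $\omega^{-1}$ appearing here are defined). The same $h$ is used throughout. Notation: $\Omega(t)=\int_0^t\omega(\tau)\,d\tau$, $\Psi(t)=\int_0^t\psi(\tau)\,d\tau$, $\chi=\omega^{-1}(1-h)$, and $a$ is a positive number such that $\|f(x_0)+g(x_0)\|\le a$. *)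

theory Defs
  imports "HOL-Analysis.Analysis"
begin

definition class_N :: "(real \<Rightarrow> real) set" where
  "class_N = {\<omega>. \<omega> ` {0..} \<subseteq> {0..} \<and> continuous_on {0..} \<omega> \<and> strict_mono_on {0..} \<omega> \<and>
     concave_on {0..} \<omega> \<and> \<omega> 0 = 0}"

text \<open>The inverse of \<open>\<omega> : [0,\<infinity>) \<rightarrow> [0,\<infinity>)\<close>. Functions in \<^const>\<open>class_N\<close> may be bounded, so this
  is meaningful only on \<open>\<omega> ` {0..}\<close>.\<close>

definition modulus_inv :: "(real \<Rightarrow> real) \<Rightarrow> real \<Rightarrow> real" where
  "modulus_inv \<omega> = inv_into {0..} \<omega>"

text \<open>On interior points of \<open>D\<close> the derivative within \<open>D\<close> is the usual Frechet derivative; at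
  the other points of \<open>D\<close> it is the only available reading, \<open>f\<close> being given on \<open>D\<close> only.\<close>

definition derivative_on ::
  "('a::real_normed_vector \<Rightarrow> 'b::real_normed_vector) \<Rightarrow> ('a \<Rightarrow> 'a \<Rightarrow>\<^sub>L 'b) \<Rightarrow> 'a set \<Rightarrow> bool" where
  "derivative_on f f' D \<longleftrightarrow> (\<forall>x\<in>D. (f has_derivative blinfun_apply (f' x)) (at x within D))"

definition smoothness_gap ::
  "('a::real_normed_vector \<Rightarrow> 'a \<Rightarrow>\<^sub>L 'b::real_normed_vector) \<Rightarrow> real \<Rightarrow> 'a \<Rightarrow> 'a \<Rightarrow> real" where
  "smoothness_gap f' h x' x'' = min (norm (f' x')) (norm (f' x'')) - h"

text \<open>The two membership conditions say that the values of the inverse of \<open>\<omega>\<close> in the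
  inequality are defined.\<close>

definition regularly_smooth_on ::
  "(real \<Rightarrow> real) \<Rightarrow> real \<Rightarrow> ('a::real_normed_vector \<Rightarrow> 'b::real_normed_vector) \<Rightarrow>
     ('a \<Rightarrow> 'a \<Rightarrow>\<^sub>L 'b) \<Rightarrow> 'a set \<Rightarrow> bool" where
  "regularly_smooth_on \<omega> h f f' D \<longleftrightarrow>
     derivative_on f f' D \<and> 0 \<le> h \<and> h \<le> (INF x\<in>D. norm (f' x)) \<and>
     (\<forall>x'\<in>D. \<forall>x''\<in>D.
        smoothness_gap f' h x' x'' \<in> \<omega> ` {0..} \<and>
        smoothness_gap f' h x' x'' + norm (f' x'' - f' x') \<in> \<omega> ` {0..} \<and>
        modulus_inv \<omega> (smoothness_gap f' h x' x'' + norm (f' x'' - f' x'))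
          - modulus_inv \<omega> (smoothness_gap f' h x' x'') \<le> norm (x'' - x'))"

text \<open>The antiderivative \<open>\<integral>\<^sub>0\<^sup>t \<omega>\<close>, used for \<open>t \<ge> 0\<close>.\<close>

definition primitive :: "(real \<Rightarrow> real) \<Rightarrow> real \<Rightarrow> real" where
  "primitive \<omega> t = integral {0..t} \<omega>"

definition majorant ::
  "(real \<Rightarrow> real) \<Rightarrow> (real \<Rightarrow> real) \<Rightarrow> real \<Rightarrow> real \<Rightarrow> real \<Rightarrow> real \<Rightarrow> real" where
  "majorant \<omega> \<psi> a h chi t =
     a - primitive \<omega> chi + primitive \<omega> (chi - t) - t * h + primitive \<psi> t"

primrec majorant_seq ::
  "(real \<Rightarrow> real) \<Rightarrow> (real \<Rightarrow> real) \<Rightarrow> real \<Rightarrow> real \<Rightarrow> real \<Rightarrow> nat \<Rightarrow> real" where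
  "majorant_seq \<omega> \<psi> a h chi 0 = 0"
| "majorant_seq \<omega> \<psi> a h chi (Suc n) =
     majorant_seq \<omega> \<psi> a h chi n
       + majorant \<omega> \<psi> a h chi (majorant_seq \<omega> \<psi> a h chi n)
           / (h + \<omega> (chi - majorant_seq \<omega> \<psi> a h chi n))"

definition is_blinfun_inverse ::
  "('a::real_normed_vector \<Rightarrow>\<^sub>L 'b::real_normed_vector) \<Rightarrow> ('b \<Rightarrow>\<^sub>L 'a) \<Rightarrow> bool" where
  "is_blinfun_inverse A B \<longleftrightarrow> A o\<^sub>L B = id_blinfun \<and> B o\<^sub>L A = id_blinfun"

definition blinfun_invertible ::
  "('a::real_normed_vector \<Rightarrow>\<^sub>L 'b::real_normed_vector) \<Rightarrow> bool" where
  "blinfun_invertible A \<longleftrightarrow> (\<exists>B. is_blinfun_inverse A B)"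

definition blinfun_inverse ::
  "('a::real_normed_vector \<Rightarrow>\<^sub>L 'b::real_normed_vector) \<Rightarrow> ('b \<Rightarrow>\<^sub>L 'a)" where
  "blinfun_inverse A = (THE B. is_blinfun_inverse A B)"

text \<open>The iterate with index \<open>Suc n\<close> is properly defined when the iterate \<open>x\<close> with index \<open>n\<close> is,
  lies in the domain of \<open>f\<close>, \<open>g\<close>, and \<open>f' x\<close> is invertible.\<close>

primrec successive_approx ::
  "('a::real_normed_vector \<Rightarrow> 'b::real_normed_vector) \<Rightarrow> ('a \<Rightarrow> 'b) \<Rightarrow> ('a \<Rightarrow> 'a \<Rightarrow>\<^sub>L 'b) \<Rightarrow> 'a \<Rightarrow>
     nat \<Rightarrow> 'a" where
  "successive_approx f g f' x0 0 = x0"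
| "successive_approx f g f' x0 (Suc n) =
     (let x = successive_approx f g f' x0 n
      in x - blinfun_apply (blinfun_inverse (f' x)) (f x + g x))"

end

theory Submission
  imports Defs
begin

text \<open>
  The scalar recursion is a Newton-like iteration for \<open>W = majorant \<omega> \<psi> a h chi\<close>, in which the slope
  \<open>- (h + \<omega> (chi - t))\<close> omits the derivative of the summand coming from \<open>g\<close>, exactly as the operator
  iteration inverts \<open>f'\<close> only. The rest of \<open>W\<close> is strictly convex and the omitted
  summand is nondecreasing, so a scalar step never passes the zero \<open>t_star\<close>
  (\<open>W_decrease_less\<close>), and the scalar sequence increases to \<open>t_star\<close>.

  The operator iteration is compared with the scalar one through a single estimate,
  \<open>majorized_error\<close>: if \<open>norm (x - x0) \<le> r\<close> and \<open>norm (y - x) \<le> s - r\<close>, then the error of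
  replacing \<open>f y + g y\<close> by \<open>f x + g x + f' x (y - x)\<close> is at most the error of replacing \<open>W s\<close> by
  \<open>W r - (h + \<omega> (chi - r)) (s - r)\<close>. For \<open>f\<close> this comes from
  \<open>norm (f' y - f' x) \<le> \<omega> (chi - r) - \<omega> (chi - s)\<close> (\<open>derivative_diff_bound\<close>, where regular
  smoothness and concavity enter) by integration along a segment; for \<open>g\<close>, which need not be
  differentiable, it comes from summing Lipschitz bounds over fine partitions of the segment
  (\<open>curve_increment_le_primitive\<close>). The same bound with \<open>x = x0\<close>, where \<open>f'\<close> is the identity and
  \<open>\<omega> chi = 1 - h\<close>, makes \<open>f'\<close> invertible with inverse of norm at most
  \<open>1 / (h + \<omega> (chi - r))\<close>.

  Taking consecutive iterates for \<open>x\<close> and \<open>y\<close> shows by induction that residuals are bounded by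
  \<open>W\<close> and steps by the scalar steps, whence convergence to a root. Taking an arbitrary root of the
  ball for \<open>y\<close> and \<open>s = t_star\<close> shows, again by induction, that its distance to the \<open>n\<close>-th iterate
  is at most \<open>t_star - t\<^sub>n\<close>; this is both the error bound and uniqueness.
\<close>

section \<open>Integrals of monotone functions\<close>

lemma concave_on_increment_antimono:
  fixes \<omega> :: "real \<Rightarrow> real"
  assumes conc: "concave_on {0..} \<omega>" and "0 \<le> v" "v \<le> u" "0 \<le> s"
  shows "\<omega> (u + s) - \<omega> u \<le> \<omega> (v + s) - \<omega> v"
proof (cases "u - v + s = 0")
  case True
  then have "u = v" "s = 0" using assms by auto
  then show ?thesis by simp
next
  case False
  then have pos: "0 < u - v + s" using assms by simp
  \<comment> \<open>Both \<open>v + s\<close> and \<open>u\<close> are convex combinations of \<open>v\<close> and \<open>u + s\<close>, with exchanged weights.\<close>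
  define l where "l = s / (u - v + s)"
  have l: "0 \<le> l" "l \<le> 1" using assms pos by (auto simp: l_def)
  have ls: "l * (u - v + s) = s" using pos by (simp add: l_def)
  have v_s: "(1 - l) *\<^sub>R v + l *\<^sub>R (u + s) = v + s"
    using ls by (simp add: algebra_simps)
  have u: "(1 - (1 - l)) *\<^sub>R v + (1 - l) *\<^sub>R (u + s) = u"
    using ls by (simp add: algebra_simps)
  have "(1 - l) * \<omega> v + l * \<omega> (u + s) \<le> \<omega> (v + s)"
    using concave_onD[OF conc, of l v "u + s"] l v_s assms by simp
  moreover have "(1 - (1 - l)) * \<omega> v + (1 - l) * \<omega> (u + s) \<le> \<omega> u"
    using concave_onD[OF conc, of "1 - l" v "u + s"] l u assms by simp
  ultimately show ?thesis by (simp add: algebra_simps)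
qed

lemma mono_on_integrable:
  fixes \<psi> :: "real \<Rightarrow> real"
  assumes "mono_on {0..} \<psi>" "0 \<le> u"
  shows "\<psi> integrable_on {u..v}"
  by (rule integrable_on_mono_on) (use assms in \<open>auto simp: monotone_on_def\<close>)

lemma primitive_diff:
  assumes "f integrable_on {0..v}" "0 \<le> u" "u \<le> v"
  shows "primitive f v - primitive f u = integral {u..v} f"
  using Henstock_Kurzweil_Integration.integral_combine[of 0 u v f] assms by (simp add: primitive_def)

lemma primitive_mono_on_bounds:
  assumes \<psi>: "mono_on {0..} \<psi>" and uv: "0 \<le> u" "u \<le> v"
  shows "\<psi> u * (v - u) \<le> primitive \<psi> v - primitive \<psi> u"
    and "primitive \<psi> v - primitive \<psi> u \<le> \<psi> v * (v - u)"
proof -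
  have int: "\<psi> integrable_on {u..v}" using mono_on_integrable[OF \<psi>] uv by simp
  have eq: "primitive \<psi> v - primitive \<psi> u = integral {u..v} \<psi>"
    using primitive_diff mono_on_integrable[OF \<psi>] uv by simp
  have "integral {u..v} (\<lambda>_. \<psi> u) \<le> integral {u..v} \<psi>"
    by (rule integral_le) (use uv \<psi> int in \<open>auto simp: monotone_on_def\<close>)
  then show "\<psi> u * (v - u) \<le> primitive \<psi> v - primitive \<psi> u"
    using uv by (simp add: eq algebra_simps)
  have "integral {u..v} \<psi> \<le> integral {u..v} (\<lambda>_. \<psi> v)"
    by (rule integral_le) (use uv \<psi> int in \<open>auto simp: monotone_on_def\<close>)
  then show "primitive \<psi> v - primitive \<psi> u \<le> \<psi> v * (v - u)"
    using uv by (simp add: eq algebra_simps)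
qed

lemma continuous_on_primitive:
  assumes "mono_on {0..} \<psi>"
  shows "continuous_on {0..b} (primitive \<psi>)"
  unfolding primitive_def
  by (intro indefinite_integral_continuous_1 mono_on_integrable assms) simp

text \<open>On a short subinterval the local bound exceeds the integral by at most the length times the
  increase of \<open>\<psi>\<close>. Over a partition into \<open>N\<close> equal parts these excesses telescope to
  \<open>(s - r) (\<psi> s - \<psi> r) / N\<close>.\<close>

lemma curve_increment_le_primitive:
  fixes e :: "real \<Rightarrow> 'a::real_normed_vector"
  assumes \<psi>: "mono_on {0..} \<psi>" and rs: "0 \<le> r" "r \<le> s"
    and bound: "\<And>u v. r \<le> u \<Longrightarrow> u \<le> v \<Longrightarrow> v \<le> s \<Longrightarrow> norm (e v - e u) \<le> \<psi> v * (v - u)"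
  shows "norm (e s - e r) \<le> primitive \<psi> s - primitive \<psi> r"
proof -
  have step: "norm (e s - e r) - (primitive \<psi> s - primitive \<psi> r)
      \<le> (s - r) * (\<psi> s - \<psi> r) / real N" if N: "0 < N" for N :: nat
  proof -
    define d where "d = (s - r) / real N"
    have d: "0 \<le> d" using rs by (simp add: d_def)
    have Nd: "real N * d = s - r" using N by (simp add: d_def)
    have "norm (e (r + k * d) - e r) - (primitive \<psi> (r + k * d) - primitive \<psi> r)
        \<le> d * (\<psi> (r + k * d) - \<psi> r)" if "k \<le> N" for k :: nat
      using that
    proof (induction k)
      case 0
      then show ?case by simp
    next
      case (Suc k)
      let ?u = "r + k * d" and ?v = "r + Suc k * d"
      have v_u: "?v - ?u = d" by (simp add: algebra_simps)
      have "Suc k * d \<le> real N * d" using Suc.prems d by (intro mult_right_mono) auto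
      then have vs: "?v \<le> s" using Nd by simp
      have ru: "r \<le> ?u" using d by simp
      have uv: "?u \<le> ?v" using v_u d by linarith
      have "norm (e ?v - e r) \<le> norm (e ?v - e ?u) + norm (e ?u - e r)"
        using norm_triangle_ineq[of "e ?v - e ?u" "e ?u - e r"] by simp
      moreover have "norm (e ?v - e ?u) \<le> \<psi> ?v * d"
        using bound[OF ru uv vs] by (simp only: v_u)
      moreover have "\<psi> ?u * d \<le> primitive \<psi> ?v - primitive \<psi> ?u"
        using primitive_mono_on_bounds(1)[OF \<psi> _ uv] ru rs by (simp only: v_u)
      moreover have "norm (e ?u - e r) - (primitive \<psi> ?u - primitive \<psi> r) \<le> d * (\<psi> ?u - \<psi> r)"
        using Suc by simp
      ultimately show ?case unfolding right_diff_distrib mult.commute[of _ d] by linarith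
    qed
    from this[of N] show ?thesis using Nd by (simp add: d_def)
  qed
  have "(\<lambda>N. (s - r) * (\<psi> s - \<psi> r) / real N) \<longlonglongrightarrow> 0"
    by (rule lim_const_over_n)
  then have "norm (e s - e r) - (primitive \<psi> s - primitive \<psi> r) \<le> 0"
    by (rule LIMSEQ_le_const) (use step in \<open>auto intro!: exI[of _ 1]\<close>)
  then show ?thesis by simp
qed

section \<open>The scalar majorant\<close>

locale majorant_setup =
  fixes \<omega> \<psi> :: "real \<Rightarrow> real" and a h chi t_star :: real
  assumes \<omega>: "\<omega> \<in> class_N"
    and \<psi>_nonneg: "\<forall>t\<ge>0. 0 \<le> \<psi> t" and \<psi>_mono: "mono_on {0..} \<psi>"
    and h_nonneg: "0 \<le> h" and a_pos: "0 < a"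
    and t_star: "t_star \<in> {0..chi}" "majorant \<omega> \<psi> a h chi t_star = 0"
    and t_star_unique: "\<forall>t\<in>{0..chi}. majorant \<omega> \<psi> a h chi t = 0 \<longrightarrow> t = t_star"
    and a_less: "a < primitive \<omega> chi + h * chi - primitive \<psi> chi"
begin

abbreviation "W \<equiv> majorant \<omega> \<psi> a h chi"
abbreviation "T \<equiv> majorant_seq \<omega> \<psi> a h chi"

declare majorant_seq.simps(2) [simp del]

lemma \<omega>_cont: "continuous_on {0..} \<omega>" and \<omega>_strict_mono: "strict_mono_on {0..} \<omega>"
  and \<omega>_concave: "concave_on {0..} \<omega>" and \<omega>_0: "\<omega> 0 = 0"
  using \<omega> by (auto simp: class_N_def)

lemma \<omega>_less: "0 \<le> u \<Longrightarrow> u < v \<Longrightarrow> \<omega> u < \<omega> v"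
  using \<omega>_strict_mono by (auto simp: monotone_on_def)

lemma \<omega>_mono: "mono_on {0..} \<omega>"
  using \<omega>_strict_mono by (rule strict_mono_on_imp_mono_on)

lemma \<omega>_le: "0 \<le> u \<Longrightarrow> u \<le> v \<Longrightarrow> \<omega> u \<le> \<omega> v"
  using \<omega>_mono by (auto simp: monotone_on_def)

lemma primitive_\<omega>_less:
  assumes "0 \<le> u" "u < v"
  shows "primitive \<omega> v - primitive \<omega> u < \<omega> v * (v - u)"
proof -
  define m where "m = (u + v) / 2"
  have m: "u < m" "m < v" using assms by (auto simp: m_def)
  have "primitive \<omega> v - primitive \<omega> m \<le> \<omega> v * (v - m)"
    using primitive_mono_on_bounds(2)[OF \<omega>_mono, of m v] m assms by simp
  moreover have "primitive \<omega> m - primitive \<omega> u \<le> \<omega> m * (m - u)"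
    using primitive_mono_on_bounds(2)[OF \<omega>_mono, of u m] m assms by simp
  moreover have "\<omega> m * (m - u) < \<omega> v * (m - u)"
    using \<omega>_less[of m v] m assms by simp
  ultimately show ?thesis by (simp add: algebra_simps)
qed

lemma continuous_on_W: "continuous_on {0..chi} W"
proof -
  have "continuous_on {0..chi} (\<lambda>t. primitive \<omega> (chi - t))"
    by (rule continuous_on_compose2[OF continuous_on_primitive[OF \<omega>_mono, of chi]])
       (auto intro!: continuous_intros)
  then show ?thesis
    unfolding majorant_def
    by (intro continuous_intros continuous_on_primitive \<psi>_mono) auto
qed

lemma W_0: "W 0 = a"
  by (simp add: majorant_def primitive_def)

lemma t_star_less_chi: "t_star < chi"
proof -
  have "W chi < 0" using a_less by (simp add: majorant_def primitive_def mult.commute)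
  then have "t_star \<noteq> chi" using t_star by auto
  then show ?thesis using t_star by simp
qed

lemma W_pos:
  assumes "0 \<le> t" "t < t_star"
  shows "0 < W t"
proof (rule ccontr)
  assume "\<not> 0 < W t"
  then have "\<exists>s. 0 \<le> s \<and> s \<le> t \<and> W s = 0"
    using assms t_star_less_chi W_0 a_pos
    by (intro IVT2' continuous_on_subset[OF continuous_on_W]) auto
  then show False using t_star_unique assms t_star by force
qed

lemma t_star_pos: "0 < t_star"
  using t_star W_0 a_pos by (cases "t_star = 0") auto

lemma slope_pos: "t < chi \<Longrightarrow> 0 < h + \<omega> (chi - t)"
  using \<omega>_less[of 0 "chi - t"] \<omega>_0 h_nonneg by simp

text \<open>\<open>- (h + \<omega> (chi - r))\<close> is the slope at \<open>r\<close> of \<open>W\<close> without its nondecreasing summand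
  \<open>primitive \<psi>\<close>, and that part of \<open>W\<close> is strictly convex. At \<open>s = t_star\<close> this is why a step with
  this slope stays below \<open>t_star\<close>.\<close>

lemma W_decrease_less:
  assumes "0 \<le> r" "r < s" "s \<le> chi"
  shows "W r - W s < (h + \<omega> (chi - r)) * (s - r)"
proof -
  have "primitive \<omega> (chi - r) - primitive \<omega> (chi - s) < \<omega> (chi - r) * (s - r)"
    using primitive_\<omega>_less[of "chi - s" "chi - r"] assms by simp
  moreover have "0 \<le> \<psi> r * (s - r)" using \<psi>_nonneg assms by simp
  then have "primitive \<psi> r \<le> primitive \<psi> s"
    using primitive_mono_on_bounds(1)[OF \<psi>_mono, of r s] assms by linarith
  ultimately show ?thesis by (simp add: majorant_def algebra_simps)
qed

lemma T_Suc_diff: "T (Suc n) - T n = W (T n) / (h + \<omega> (chi - T n))"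
  by (simp add: majorant_seq.simps(2))

lemma T_range: "0 \<le> T n \<and> T n < t_star"
proof (induction n)
  case 0
  then show ?case using t_star_pos by simp
next
  case (Suc n)
  have k: "0 < h + \<omega> (chi - T n)" using Suc t_star_less_chi by (intro slope_pos) simp
  have "W (T n) < (h + \<omega> (chi - T n)) * (t_star - T n)"
    using W_decrease_less[of "T n" t_star] Suc t_star by simp
  then have "T (Suc n) - T n < t_star - T n"
    unfolding T_Suc_diff using k by (simp add: field_simps)
  moreover have "0 < T (Suc n) - T n"
    unfolding T_Suc_diff using k W_pos Suc by simp
  ultimately show ?case using Suc by linarith
qed

lemma T_in_Icc: "T n \<in> {0..chi}"
  using T_range[of n] t_star_less_chi by simp

lemma T_slope_pos: "0 < h + \<omega> (chi - T n)"
  using T_range[of n] t_star_less_chi by (intro slope_pos) simp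

lemma T_step: "W (T n) = (h + \<omega> (chi - T n)) * (T (Suc n) - T n)"
  unfolding T_Suc_diff using T_slope_pos[of n] by simp

lemma T_less: "T n < T (Suc n)"
proof -
  have "0 < T (Suc n) - T n"
    unfolding T_Suc_diff using T_slope_pos[of n] W_pos T_range[of n] by simp
  then show ?thesis by linarith
qed

lemma strict_mono_T: "strict_mono T"
  using T_less unfolding strict_mono_Suc_iff by blast

text \<open>The slopes are bounded by \<open>h + \<omega> chi\<close>, so the defects \<open>W (T n)\<close> tend to zero with the steps,
  and \<open>t_star\<close> is the only zero available as a limit.\<close>

lemma T_LIMSEQ: "T \<longlonglongrightarrow> t_star"
proof -
  obtain L where L: "T \<longlonglongrightarrow> L" and TL: "\<And>n. T n \<le> L"
  proof (rule incseq_convergent)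
    show "incseq T" using strict_mono_T by (rule strict_mono_mono)
    show "\<forall>i. T i \<le> t_star" using T_range less_imp_le by blast
  qed blast
  have L_le: "L \<le> t_star"
    using L by (rule LIMSEQ_le_const2) (use T_range in \<open>auto intro: less_imp_le\<close>)
  have L0: "0 \<le> L" using TL[of 0] by simp
  have L_chi: "L \<in> {0..chi}" using L0 L_le t_star by auto
  have "(\<lambda>n. W (T n)) \<longlonglongrightarrow> W L"
    by (rule continuous_on_tendsto_compose[OF continuous_on_W L L_chi])
       (simp add: T_in_Icc always_eventually del: atLeastAtMost_iff)
  moreover have "(\<lambda>n. W (T n)) \<longlonglongrightarrow> 0"
  proof (rule real_tendsto_sandwich)
    show "\<forall>\<^sub>F n in sequentially. 0 \<le> W (T n)"
      using T_range W_pos by (auto intro!: always_eventually less_imp_le)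
    have "W (T n) \<le> (h + \<omega> chi) * (T (Suc n) - T n)" for n
      unfolding T_step using \<omega>_le[of "chi - T n" chi] T_range[of n] t_star_less_chi T_less[of n]
      by (intro mult_right_mono) auto
    then show "\<forall>\<^sub>F n in sequentially. W (T n) \<le> (h + \<omega> chi) * (T (Suc n) - T n)"
      by (rule always_eventually[OF allI])
    have "(\<lambda>n. (h + \<omega> chi) * (T (Suc n) - T n)) \<longlonglongrightarrow> (h + \<omega> chi) * (L - L)"
      by (intro tendsto_intros LIMSEQ_Suc L)
    then show "(\<lambda>n. (h + \<omega> chi) * (T (Suc n) - T n)) \<longlonglongrightarrow> 0" by simp
  qed simp
  ultimately have "W L = 0" by (rule LIMSEQ_unique)
  then show ?thesis using t_star_unique L_chi L by simp
qed

end

section \<open>Invertibility near the identity\<close>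

lemma is_blinfun_inverse_apply:
  assumes "is_blinfun_inverse A B"
  shows "blinfun_apply A (blinfun_apply B y) = y" "blinfun_apply B (blinfun_apply A z) = z"
  using assms unfolding is_blinfun_inverse_def
  by (simp_all flip: blinfun_apply_blinfun_compose)

lemma is_blinfun_inverse_imp_eq:
  assumes "is_blinfun_inverse A B"
  shows "blinfun_inverse A = B"
  unfolding blinfun_inverse_def
proof (rule the_equality)
  fix C assume C: "is_blinfun_inverse A C"
  have "blinfun_apply C y = blinfun_apply B y" for y
    using is_blinfun_inverse_apply(1)[OF assms, of y]
      is_blinfun_inverse_apply(2)[OF C, of "blinfun_apply B y"] by simp
  then show "C = B" by (simp add: blinfun_eqI)
qed (fact assms)

text \<open>The equation \<open>A z = y\<close> is the fixed point equation for the contraction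
  \<open>z \<mapsto> y + (z - A z)\<close>; this gives surjectivity, while injectivity and the
  bound come from \<open>norm (A z) \<ge> norm z - norm (z - A z)\<close>.\<close>

lemma blinfun_near_id_inverse:
  fixes A :: "'a::banach \<Rightarrow>\<^sub>L 'a"
  assumes near: "norm (A - id_blinfun) \<le> 1 - k" and k: "0 < k"
  obtains B where "is_blinfun_inverse A B" "norm B \<le> 1 / k"
proof -
  define E where "E = A - id_blinfun"
  have E: "norm (blinfun_apply E z) \<le> (1 - k) * norm z" for z
    using norm_blinfun[of E z] near mult_right_mono[OF near norm_ge_zero[of z]]
    by (simp add: E_def)
  have A: "blinfun_apply A z = z + blinfun_apply E z" for z
    by (simp add: E_def blinfun.bilinear_simps)
  have below: "k * norm z \<le> norm (blinfun_apply A z)" for z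
    using E[of z] norm_triangle_ineq2[of z "- blinfun_apply E z"]
    by (simp add: A algebra_simps)
  have k1: "0 \<le> 1 - k" using near norm_ge_zero[of "A - id_blinfun"] by linarith
  have ex1: "\<exists>!z. blinfun_apply A z = y" for y
  proof -
    have "\<exists>!z. y - blinfun_apply E z = z"
    proof (rule banach_fix_type)
      show "\<forall>z z'. dist (y - blinfun_apply E z) (y - blinfun_apply E z') \<le> (1 - k) * dist z z'"
        by (auto simp: dist_norm simp flip: blinfun.diff_right intro!: order_trans[OF E] simp: norm_minus_commute)
    qed (use k k1 in auto)
    then show ?thesis by (simp add: A eq_diff_eq diff_eq_eq eq_commute[of y])
  qed
  define B where "B y = (THE z. blinfun_apply A z = y)" for y
  have AB: "blinfun_apply A (B y) = y" for y
    unfolding B_def using ex1 by (rule theI')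
  have BA: "B (blinfun_apply A z) = z" for z
    using ex1[of "blinfun_apply A z"] AB by blast
  have B_bound: "norm (B y) \<le> norm y * (1 / k)" for y
    using below[of "B y"] k by (simp add: AB field_simps)
  have B: "bounded_linear B"
  proof (rule bounded_linear_intro[OF _ _ B_bound])
    show "B (x + y) = B x + B y" for x y
      using BA[of "B x + B y"] by (simp add: blinfun.bilinear_simps AB)
    show "B (c *\<^sub>R x) = c *\<^sub>R B x" for c x
      using BA[of "c *\<^sub>R B x"] by (simp add: blinfun.bilinear_simps AB)
  qed
  have "is_blinfun_inverse A (Blinfun B)"
    using B by (auto simp: is_blinfun_inverse_def bounded_linear_Blinfun_apply AB BA intro!: blinfun_eqI)
  moreover have "norm (Blinfun B) \<le> 1 / k"
    using B B_bound k by (intro norm_blinfun_bound) (auto simp: bounded_linear_Blinfun_apply mult.commute)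
  ultimately show thesis by (rule that)
qed

section \<open>The operator equation\<close>

locale operator_setup = majorant_setup \<omega> \<psi> a h chi t_star
  for \<omega> \<psi> :: "real \<Rightarrow> real" and a h chi t_star :: real +
  fixes D :: "'a::banach set" and x0 :: 'a
    and f g :: "'a \<Rightarrow> 'a" and f' :: "'a \<Rightarrow> 'a \<Rightarrow>\<^sub>L 'a"
  assumes norm_id: "norm (id_blinfun :: 'a \<Rightarrow>\<^sub>L 'a) = 1"
    and f'_x0: "f' x0 = id_blinfun"
    and smooth: "regularly_smooth_on \<omega> h f f' D"
    and g_lipschitz: "\<forall>t\<ge>0. cball x0 t \<subseteq> D \<longrightarrow>
       (\<forall>x'\<in>cball x0 t. \<forall>x''\<in>cball x0 t. norm (g x'' - g x') \<le> \<psi> t * norm (x'' - x'))"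
    and residual_x0: "norm (f x0 + g x0) \<le> a"
    and chi_def: "chi = modulus_inv \<omega> (1 - h)"
    and ball_subset: "cball x0 t_star \<subseteq> D"
begin

abbreviation "X \<equiv> successive_approx f g f' x0"

lemma modulus_inv_nonneg: "y \<in> \<omega> ` {0..} \<Longrightarrow> 0 \<le> modulus_inv \<omega> y"
  using inv_into_into[of y \<omega> "{0..}"] by (simp add: modulus_inv_def)

lemma \<omega>_modulus_inv: "y \<in> \<omega> ` {0..} \<Longrightarrow> \<omega> (modulus_inv \<omega> y) = y"
  by (simp add: modulus_inv_def f_inv_into_f)

lemma
  assumes "x \<in> D" "y \<in> D"
  shows gap_in_range: "smoothness_gap f' h x y \<in> \<omega> ` {0..}"
    and gap_plus_in_range: "smoothness_gap f' h x y + norm (f' y - f' x) \<in> \<omega> ` {0..}"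
    and smooth_ineq: "modulus_inv \<omega> (smoothness_gap f' h x y + norm (f' y - f' x))
      \<le> modulus_inv \<omega> (smoothness_gap f' h x y) + norm (y - x)"
proof -
  have "smoothness_gap f' h x y \<in> \<omega> ` {0..} \<and>
      smoothness_gap f' h x y + norm (f' y - f' x) \<in> \<omega> ` {0..} \<and>
      modulus_inv \<omega> (smoothness_gap f' h x y + norm (f' y - f' x))
        - modulus_inv \<omega> (smoothness_gap f' h x y) \<le> norm (y - x)"
    using smooth assms unfolding regularly_smooth_on_def by blast
  then show "smoothness_gap f' h x y \<in> \<omega> ` {0..}"
    "smoothness_gap f' h x y + norm (f' y - f' x) \<in> \<omega> ` {0..}"
    "modulus_inv \<omega> (smoothness_gap f' h x y + norm (f' y - f' x))
      \<le> modulus_inv \<omega> (smoothness_gap f' h x y) + norm (y - x)"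
    by (blast, blast, linarith)
qed

lemma f_derivative: "x \<in> D \<Longrightarrow> (f has_derivative blinfun_apply (f' x)) (at x within D)"
  using smooth unfolding regularly_smooth_on_def derivative_on_def by blast

lemma x0_in_D: "x0 \<in> D"
  using ball_subset t_star by auto

lemma \<omega>_chi: "\<omega> chi = 1 - h"
  using \<omega>_modulus_inv[OF gap_in_range[OF x0_in_D x0_in_D]]
  by (simp only: smoothness_gap_def f'_x0 norm_id min.idem flip: chi_def)

lemma \<omega>_le_imp_le: "0 \<le> v \<Longrightarrow> \<omega> u \<le> \<omega> v \<Longrightarrow> u \<le> v"
  using \<omega>_less[of v u] by linarith

text \<open>If \<open>norm (f' y) < 1\<close>, then \<open>norm (f' y - f' x0)\<close> is at least the missing amount
  \<open>1 - norm (f' y)\<close>, so the regular smoothness inequality for \<open>x0\<close> and \<open>y\<close> limits how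
  far the value of \<open>\<omega>\<^sup>-\<^sup>1\<close> can have dropped below \<open>chi\<close>.\<close>

lemma modulus_inv_norm_ge:
  assumes y: "y \<in> D"
  shows "chi - norm (y - x0) \<le> modulus_inv \<omega> (norm (f' y) - h)"
proof -
  have range: "norm (f' y) - h \<in> \<omega> ` {0..}"
    using gap_in_range[OF y y] unfolding smoothness_gap_def min.idem .
  show ?thesis
  proof (cases "1 \<le> norm (f' y)")
    case True
    then have "chi \<le> modulus_inv \<omega> (norm (f' y) - h)"
      using \<omega>_modulus_inv[OF range] \<omega>_chi
      by (intro \<omega>_le_imp_le[OF modulus_inv_nonneg[OF range]]) linarith
    then show ?thesis using norm_ge_zero[of "y - x0"] by linarith
  next
    case False
    then have gap: "smoothness_gap f' h x0 y = norm (f' y) - h"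
      by (simp add: smoothness_gap_def f'_x0 norm_id)
    have "1 \<le> norm (f' y) + norm (f' y - f' x0)"
      using norm_triangle_ineq2[of "f' x0" "f' y"] by (simp add: f'_x0 norm_id norm_minus_commute)
    then have "chi \<le> modulus_inv \<omega> (smoothness_gap f' h x0 y + norm (f' y - f' x0))"
      using \<omega>_modulus_inv[OF gap_plus_in_range[OF x0_in_D y]] \<omega>_chi gap
      by (intro \<omega>_le_imp_le[OF modulus_inv_nonneg[OF gap_plus_in_range[OF x0_in_D y]]]) linarith
    then show ?thesis using smooth_ineq[OF x0_in_D y] unfolding gap by linarith
  qed
qed

text \<open>By concavity the increment of \<open>\<omega>\<close> over a step of given length is largest at the smallest
  admissible base point, which is \<open>chi - s\<close>.\<close>

lemma derivative_diff_bound: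
  assumes x: "x \<in> D" and y: "y \<in> D"
    and xr: "norm (x - x0) \<le> r" and yx: "norm (y - x) \<le> s - r" and s: "s \<le> chi"
  shows "norm (f' y - f' x) \<le> \<omega> (chi - r) - \<omega> (chi - s)"
proof -
  define gap where "gap = smoothness_gap f' h x y"
  define u where "u = modulus_inv \<omega> gap"
  define d where "d = norm (y - x)"
  have d: "0 \<le> d" "d \<le> s - r" using yx by (auto simp: d_def)
  have ys: "norm (y - x0) \<le> s"
    using norm_triangle_ineq[of "y - x" "x - x0"] xr yx by simp
  have "gap = norm (f' x) - h \<or> gap = norm (f' y) - h"
    by (auto simp: gap_def smoothness_gap_def min_def)
  then have u_ge: "chi - s \<le> u"
    using modulus_inv_norm_ge[OF x] modulus_inv_norm_ge[OF y] xr ys d by (auto simp: u_def)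
  have \<omega>_u: "\<omega> u = gap"
    unfolding u_def gap_def by (rule \<omega>_modulus_inv[OF gap_in_range[OF x y]])
  have "gap + norm (f' y - f' x) = \<omega> (modulus_inv \<omega> (gap + norm (f' y - f' x)))"
    unfolding gap_def by (rule \<omega>_modulus_inv[OF gap_plus_in_range[OF x y], symmetric])
  also have "\<dots> \<le> \<omega> (u + d)"
    unfolding gap_def u_def d_def
    by (rule \<omega>_le[OF modulus_inv_nonneg[OF gap_plus_in_range[OF x y]] smooth_ineq[OF x y]])
  finally have "norm (f' y - f' x) \<le> \<omega> (u + d) - \<omega> u" by (simp add: \<omega>_u)
  also have "\<dots> \<le> \<omega> (chi - s + d) - \<omega> (chi - s)"
    using s u_ge d by (intro concave_on_increment_antimono \<omega>_concave) auto
  also have "\<dots> \<le> \<omega> (chi - r) - \<omega> (chi - s)"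
    using s d by (intro diff_right_mono \<omega>_le) auto
  finally show ?thesis .
qed

lemma derivative_inverse:
  assumes "x \<in> D" "norm (x - x0) \<le> r" "r < chi"
  obtains B where "is_blinfun_inverse (f' x) B" "norm B \<le> 1 / (h + \<omega> (chi - r))"
proof (rule blinfun_near_id_inverse)
  show "norm (f' x - id_blinfun) \<le> 1 - (h + \<omega> (chi - r))"
    using derivative_diff_bound[of x0 x 0 r] assms x0_in_D by (simp add: f'_x0 \<omega>_chi)
  show "0 < h + \<omega> (chi - r)" using assms by (intro slope_pos)
qed

text \<open>Along the segment from \<open>x\<close> to \<open>y\<close>, parametrized by \<open>[r, s]\<close>, the derivative of the
  linearization error is dominated by that of the corresponding scalar error.\<close>

lemma linearization_error:
  assumes xr: "norm (x - x0) \<le> r" and yx: "norm (y - x) \<le> s - r" and rs: "r < s" "s \<le> t_star"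
  shows "norm (f y - f x - blinfun_apply (f' x) (y - x))
    \<le> \<omega> (chi - r) * (s - r) + primitive \<omega> (chi - s) - primitive \<omega> (chi - r)"
proof -
  define c where "c \<tau> = (\<tau> - r) / (s - r)" for \<tau>
  define p where "p \<tau> = x + c \<tau> *\<^sub>R (y - x)" for \<tau>
  have r0: "0 \<le> r" using xr norm_ge_zero[of "x - x0"] by linarith
  have s_chi: "s \<le> chi" using rs t_star_less_chi by simp
  have px: "norm (p \<tau> - x) \<le> \<tau> - r" if "\<tau> \<in> {r..s}" for \<tau>
  proof -
    have "norm (p \<tau> - x) = c \<tau> * norm (y - x)" using that rs by (simp add: p_def c_def)
    also have "\<dots> \<le> c \<tau> * (s - r)" using that yx by (intro mult_left_mono) (auto simp: c_def)
    finally show ?thesis using rs by (simp add: c_def)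
  qed
  have pD: "p \<tau> \<in> D" if "\<tau> \<in> {r..s}" for \<tau>
  proof -
    have "norm (p \<tau> - x0) \<le> t_star"
      using norm_triangle_ineq[of "p \<tau> - x" "x - x0"] px[OF that] xr that rs by simp
    then show ?thesis using ball_subset by (auto simp: dist_norm norm_minus_commute)
  qed
  have xD: "x \<in> D" using pD[of r] rs by (simp add: p_def c_def)
  define q where "q \<tau> = f (p \<tau>) - c \<tau> *\<^sub>R blinfun_apply (f' x) (y - x)" for \<tau>
  define q' where "q' \<tau> = (1 / (s - r)) *\<^sub>R blinfun_apply (f' (p \<tau>) - f' x) (y - x)" for \<tau>
  have der_q: "(q has_vector_derivative q' \<tau>) (at \<tau> within {r..s})" if "\<tau> \<in> {r..s}" for \<tau>
  proof -
    have der_p: "(p has_derivative (\<lambda>h. (h / (s - r)) *\<^sub>R (y - x))) (at \<tau> within {r..s})"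
      unfolding p_def c_def using rs by (auto intro!: derivative_eq_intros)
    have "((\<lambda>\<tau>. f (p \<tau>)) has_derivative
        (\<lambda>h. blinfun_apply (f' (p \<tau>)) ((h / (s - r)) *\<^sub>R (y - x)))) (at \<tau> within {r..s})"
      by (rule has_derivative_in_compose2[OF f_derivative _ that der_p]) (use pD in auto)
    then have "(q has_derivative (\<lambda>h. blinfun_apply (f' (p \<tau>)) ((h / (s - r)) *\<^sub>R (y - x))
        - (h / (s - r)) *\<^sub>R blinfun_apply (f' x) (y - x))) (at \<tau> within {r..s})"
      unfolding q_def c_def using rs by (auto intro!: derivative_eq_intros)
    then show ?thesis
      by (simp add: has_vector_derivative_def q'_def blinfun.bilinear_simps algebra_simps)
  qed
  define \<phi> where "\<phi> \<tau> = \<omega> (chi - r) * \<tau> + primitive \<omega> (chi - \<tau>)" for \<tau>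
  have der_\<phi>: "(\<phi> has_vector_derivative \<omega> (chi - r) - \<omega> (chi - \<tau>)) (at \<tau> within {r..s})"
    if "\<tau> \<in> {r..s}" for \<tau>
  proof -
    have "(primitive \<omega> has_real_derivative \<omega> z) (at z within {0..chi})" if "z \<in> {0..chi}" for z
      unfolding primitive_def using that
      by (intro integral_has_real_derivative continuous_on_subset[OF \<omega>_cont]) auto
    from DERIV_subset[OF this]
    have P: "(primitive \<omega> has_real_derivative \<omega> (chi - \<tau>))
        (at (chi - \<tau>) within (\<lambda>\<tau>. chi - \<tau>) ` {r..s})"
      using that r0 s_chi by auto
    have "((\<lambda>\<tau>. chi - \<tau>) has_real_derivative - 1) (at \<tau> within {r..s})"
      by (auto intro!: derivative_eq_intros)
    from DERIV_image_chain[OF P this]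
    have "((\<lambda>\<tau>. primitive \<omega> (chi - \<tau>)) has_real_derivative - \<omega> (chi - \<tau>)) (at \<tau> within {r..s})"
      by (simp add: o_def)
    then have "(\<phi> has_real_derivative \<omega> (chi - r) - \<omega> (chi - \<tau>)) (at \<tau> within {r..s})"
      unfolding \<phi>_def by (auto intro!: derivative_eq_intros)
    then show ?thesis by (simp add: has_real_derivative_iff_has_vector_derivative)
  qed
  have interior: "at \<tau> within {r..s} = at \<tau>" if "r < \<tau>" "\<tau> < s" for \<tau>
    using that by (simp add: at_within_Icc_at)
  have "norm (q s - q r) \<le> \<phi> s - \<phi> r"
  proof (rule differentiable_bound_general[where f' = q' and \<phi>' = "\<lambda>\<tau>. \<omega> (chi - r) - \<omega> (chi - \<tau>)"])
    show "continuous_on {r..s} q" "continuous_on {r..s} \<phi>"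
      by (rule continuous_on_vector_derivative[OF der_q], assumption)
        (rule continuous_on_vector_derivative[OF der_\<phi>])
    show "(q has_vector_derivative q' \<tau>) (at \<tau>)" if "r < \<tau>" "\<tau> < s" for \<tau>
      using der_q[of \<tau>] interior[OF that] that by simp
    show "(\<phi> has_vector_derivative \<omega> (chi - r) - \<omega> (chi - \<tau>)) (at \<tau>)" if "r < \<tau>" "\<tau> < s" for \<tau>
      using der_\<phi>[of \<tau>] interior[OF that] that by simp
    show "norm (q' \<tau>) \<le> \<omega> (chi - r) - \<omega> (chi - \<tau>)" if \<tau>: "r < \<tau>" "\<tau> < s" for \<tau>
    proof -
      have "norm (blinfun_apply (f' (p \<tau>) - f' x) (y - x)) \<le> norm (f' (p \<tau>) - f' x) * norm (y - x)"
        by (rule norm_blinfun)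
      also have "\<dots> \<le> (\<omega> (chi - r) - \<omega> (chi - \<tau>)) * (s - r)"
        using derivative_diff_bound[OF xD pD xr px, of \<tau>] \<tau> s_chi yx
        by (intro mult_mono) (auto intro!: \<omega>_le)
      finally show ?thesis using rs by (simp add: q'_def field_simps)
    qed
  qed (use rs in simp)
  moreover have "q s - q r = f y - f x - blinfun_apply (f' x) (y - x)"
    using rs by (simp add: q_def p_def c_def)
  ultimately show ?thesis by (simp add: \<phi>_def algebra_simps)
qed

lemma g_increment:
  assumes xr: "norm (x - x0) \<le> r" and yx: "norm (y - x) \<le> s - r" and rs: "r < s" "s \<le> t_star"
  shows "norm (g y - g x) \<le> primitive \<psi> s - primitive \<psi> r"
proof -
  define p where "p \<tau> = x + ((\<tau> - r) / (s - r)) *\<^sub>R (y - x)" for \<tau>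
  have r0: "0 \<le> r" using xr norm_ge_zero[of "x - x0"] by linarith
  have p_diff: "norm (p v - p u) \<le> v - u" if "u \<le> v" for u v
  proof -
    have "p v - p u = ((v - u) / (s - r)) *\<^sub>R (y - x)"
      by (simp add: p_def diff_divide_distrib flip: scaleR_diff_left)
    then have "norm (p v - p u) = (v - u) / (s - r) * norm (y - x)"
      using that rs by simp
    also have "\<dots> \<le> (v - u) / (s - r) * (s - r)"
      using that yx rs by (intro mult_left_mono) auto
    finally show ?thesis using rs by simp
  qed
  have p_ball: "norm (p u - x0) \<le> u" if "r \<le> u" for u
    using norm_triangle_ineq[of "p u - p r" "p r - x0"] p_diff[OF that] xr by (simp add: p_def[of r])
  have "norm (g (p s) - g (p r)) \<le> primitive \<psi> s - primitive \<psi> r"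
  proof (rule curve_increment_le_primitive[OF \<psi>_mono r0])
    fix u v assume uv: "r \<le> u" "u \<le> v" "v \<le> s"
    have "cball x0 v \<subseteq> D" using ball_subset uv rs by (meson cball_subset_cball_iff order_trans subset_cball)
    moreover have "p u \<in> cball x0 v" "p v \<in> cball x0 v"
      using p_ball[of u] p_ball[of v] uv by (auto simp: dist_norm norm_minus_commute)
    ultimately have "norm (g (p v) - g (p u)) \<le> \<psi> v * norm (p v - p u)"
      using g_lipschitz uv r0 by simp
    also have "\<dots> \<le> \<psi> v * (v - u)"
      using p_diff[of u v] \<psi>_nonneg uv r0 by (intro mult_left_mono) auto
    finally show "norm (g (p v) - g (p u)) \<le> \<psi> v * (v - u)" .
  qed (use rs in simp)
  then show ?thesis using rs by (simp add: p_def)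
qed

text \<open>This estimate drives everything: with \<open>y\<close> the next iterate it bounds the new residual by
  \<open>W\<close>, and with \<open>y\<close> a root it bounds the distance of the next iterate to \<open>y\<close>.\<close>

lemma majorized_error:
  assumes xr: "norm (x - x0) \<le> r" and yx: "norm (y - x) \<le> s - r" and s: "s \<le> t_star"
  shows "norm (f y + g y - (f x + g x) - blinfun_apply (f' x) (y - x))
    \<le> W s - W r + (h + \<omega> (chi - r)) * (s - r)"
proof (cases "r = s")
  case True
  then show ?thesis using yx by simp
next
  case False
  then have rs: "r < s" using order_trans[OF norm_ge_zero yx] by simp
  have "f y + g y - (f x + g x) - blinfun_apply (f' x) (y - x)
      = (f y - f x - blinfun_apply (f' x) (y - x)) + (g y - g x)" by simp
  also have "norm \<dots> \<le> norm (f y - f x - blinfun_apply (f' x) (y - x)) + norm (g y - g x)"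
    by (rule norm_triangle_ineq)
  also have "\<dots> \<le> W s - W r + (h + \<omega> (chi - r)) * (s - r)"
    using linearization_error[OF xr yx rs s] g_increment[OF xr yx rs s]
    by (simp add: majorant_def algebra_simps)
  finally show ?thesis .
qed

declare successive_approx.simps(2) [simp del]

lemma in_ball: "norm (x - x0) \<le> T n \<Longrightarrow> x \<in> cball x0 t_star"
  using T_range[of n] by (simp add: dist_norm norm_minus_commute)

lemma newton_inverse:
  assumes "norm (X n - x0) \<le> T n"
  obtains B where "is_blinfun_inverse (f' (X n)) B" "norm B \<le> 1 / (h + \<omega> (chi - T n))"
    "X (Suc n) = X n - blinfun_apply B (f (X n) + g (X n))"
proof -
  have X_D: "X n \<in> D" using in_ball[OF assms] ball_subset by blast
  have "T n < chi" using T_range[of n] t_star_less_chi by linarith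
  from derivative_inverse[OF X_D assms this]
  obtain B where B: "is_blinfun_inverse (f' (X n)) B" "norm B \<le> 1 / (h + \<omega> (chi - T n))" .
  show thesis
    by (rule that[OF B]) (simp add: successive_approx.simps(2) Let_def is_blinfun_inverse_imp_eq[OF B(1)])
qed

lemma inverse_apply_bound:
  assumes "norm B \<le> 1 / k" "norm v \<le> k * d" "0 < k"
  shows "norm (blinfun_apply B v) \<le> d"
proof -
  have "norm (blinfun_apply B v) \<le> norm B * norm v" by (rule norm_blinfun)
  also have "\<dots> \<le> (1 / k) * (k * d)" using assms by (intro mult_mono) auto
  finally show ?thesis using assms by simp
qed

lemma step_bound:
  assumes "norm (X n - x0) \<le> T n" "norm (f (X n) + g (X n)) \<le> W (T n)"
  shows "norm (X (Suc n) - X n) \<le> T (Suc n) - T n"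
proof -
  obtain B where "is_blinfun_inverse (f' (X n)) B" and B: "norm B \<le> 1 / (h + \<omega> (chi - T n))"
      "X (Suc n) = X n - blinfun_apply B (f (X n) + g (X n))"
    by (rule newton_inverse[OF assms(1)])
  then show ?thesis
    using inverse_apply_bound[OF B(1) _ T_slope_pos] assms(2) by (simp add: T_step)
qed

text \<open>Both the Newton step and the scalar step annihilate their linearizations, so
  the majorized error of a step is exactly \<open>W\<close> at the next scalar point.\<close>

lemma iterate_invariant: "norm (X n - x0) \<le> T n \<and> norm (f (X n) + g (X n)) \<le> W (T n)"
proof (induction n)
  case 0
  then show ?case using residual_x0 by (simp add: W_0)
next
  case (Suc n)
  then have step: "norm (X (Suc n) - X n) \<le> T (Suc n) - T n" by (intro step_bound) auto
  obtain B where B: "is_blinfun_inverse (f' (X n)) B" "norm B \<le> 1 / (h + \<omega> (chi - T n))"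
      "X (Suc n) = X n - blinfun_apply B (f (X n) + g (X n))"
    by (rule newton_inverse[OF conjunct1[OF Suc]])
  have lin: "blinfun_apply (f' (X n)) (X (Suc n) - X n) = - (f (X n) + g (X n))"
    by (simp add: B(3) blinfun.bilinear_simps is_blinfun_inverse_apply[OF B(1)])
  have "norm (f (X (Suc n)) + g (X (Suc n)))
      \<le> W (T (Suc n)) - W (T n) + (h + \<omega> (chi - T n)) * (T (Suc n) - T n)"
    using majorized_error[OF conjunct1[OF Suc] step] T_range[of "Suc n"] by (simp add: lin)
  then have "norm (f (X (Suc n)) + g (X (Suc n))) \<le> W (T (Suc n))"
    using T_step[of n] by simp
  moreover have "norm (X (Suc n) - x0) \<le> T (Suc n)"
    using norm_triangle_ineq[of "X (Suc n) - X n" "X n - x0"] step Suc by simp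
  ultimately show ?case by simp
qed

lemma X_step: "norm (X (Suc n) - X n) \<le> T (Suc n) - T n"
  using iterate_invariant by (intro step_bound) auto

lemma X_invertible: "blinfun_invertible (f' (X n))"
  by (rule newton_inverse[OF conjunct1[OF iterate_invariant]]) (auto simp: blinfun_invertible_def)

lemma X_in_ball: "X n \<in> cball x0 t_star"
  using in_ball iterate_invariant by blast

lemma X_diff: "norm (X (n + m) - X n) \<le> T (n + m) - T n"
proof (induction m)
  case (Suc m)
  then show ?case
    using X_step[of "n + m"] norm_triangle_ineq[of "X (n + Suc m) - X (n + m)" "X (n + m) - X n"]
    by simp
qed simp

text \<open>For a root \<open>y\<close>, the difference \<open>y - X (Suc n)\<close> is the inverse of \<open>f' (X n)\<close> applied to minus
  the linearization error from \<open>X n\<close> to \<open>y\<close>, just as \<open>t_star - T (Suc n)\<close> is the scalar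
  error from \<open>T n\<close> to \<open>t_star\<close> divided by the slope. The bound for an arbitrary root of the ball also
  forces that root to be the limit.\<close>

lemma root_distance:
  assumes y: "y \<in> cball x0 t_star" "f y + g y = 0"
  shows "norm (y - X n) \<le> t_star - T n"
proof (induction n)
  case 0
  then show ?case using y by (simp add: dist_norm norm_minus_commute)
next
  case (Suc n)
  let ?k = "h + \<omega> (chi - T n)" and ?x = "X n"
  let ?e = "f y + g y - (f ?x + g ?x) - blinfun_apply (f' ?x) (y - ?x)"
  obtain B where B: "is_blinfun_inverse (f' ?x) B" "norm B \<le> 1 / ?k"
      "X (Suc n) = ?x - blinfun_apply B (f ?x + g ?x)"
    by (rule newton_inverse[OF conjunct1[OF iterate_invariant]])
  have "y - X (Suc n) = - blinfun_apply B ?e"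
    using y(2) by (simp add: B(3) blinfun.bilinear_simps is_blinfun_inverse_apply[OF B(1)])
  moreover have "norm ?e \<le> ?k * (t_star - T (Suc n))"
    using majorized_error[OF conjunct1[OF iterate_invariant] Suc] t_star(2) T_step[of n]
    by (simp add: algebra_simps)
  ultimately show ?case
    using inverse_apply_bound[OF B(2) _ T_slope_pos] by simp
qed

lemma root_is_limit:
  assumes "y \<in> cball x0 t_star" "f y + g y = 0"
  shows "X \<longlonglongrightarrow> y"
proof -
  have "(\<lambda>n. t_star - T n) \<longlonglongrightarrow> t_star - t_star"
    by (intro tendsto_intros T_LIMSEQ)
  then have "(\<lambda>n. t_star - T n) \<longlonglongrightarrow> 0" by simp
  then have "(\<lambda>n. X n - y) \<longlonglongrightarrow> 0"
    by (rule Lim_null_comparison[rotated])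
       (use root_distance[OF assms] in \<open>simp add: norm_minus_commute\<close>)
  then show ?thesis by (rule LIM_zero_cancel)
qed

lemma root_exists: "\<exists>y\<in>cball x0 t_star. f y + g y = 0"
proof -
  have "Cauchy X"
  proof (rule metric_CauchyI)
    fix e :: real assume "0 < e"
    then obtain N where N: "\<And>m n. m \<ge> N \<Longrightarrow> n \<ge> N \<Longrightarrow> dist (T m) (T n) < e"
      using LIMSEQ_imp_Cauchy[OF T_LIMSEQ] by (metis metric_CauchyD)
    have *: "dist (X m) (X n) \<le> dist (T m) (T n)" if "n \<le> m" for m n
      using X_diff[of n "m - n"] that by (simp add: dist_norm)
    have "dist (X m) (X n) \<le> dist (T m) (T n)" for m n
      using *[of m n] *[of n m] by (metis dist_commute linear)
    then show "\<exists>M. \<forall>m\<ge>M. \<forall>n\<ge>M. dist (X m) (X n) < e" using N by (meson le_less_trans)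
  qed
  then obtain y where X_y: "X \<longlonglongrightarrow> y"
    using Cauchy_convergent convergent_def by blast
  have y: "y \<in> cball x0 t_star"
    using closed_sequentially[OF closed_cball _ X_y] X_in_ball by blast
  have "continuous_on (cball x0 t_star) f"
    using ball_subset
    by (intro has_derivative_continuous_on[of _ _ "\<lambda>x. blinfun_apply (f' x)"])
       (blast intro: has_derivative_subset[OF f_derivative])
  moreover have "continuous_on (cball x0 t_star) g"
  proof (rule lipschitz_on_continuous_on[of "\<psi> t_star"])
    show "(\<psi> t_star)-lipschitz_on (cball x0 t_star) g"
      using g_lipschitz ball_subset t_star(1) \<psi>_nonneg
      by (intro lipschitz_onI) (auto simp: dist_norm)
  qed
  ultimately have "continuous_on (cball x0 t_star) (\<lambda>x. f x + g x)"
    by (intro continuous_intros)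
  then have "(\<lambda>n. f (X n) + g (X n)) \<longlonglongrightarrow> f y + g y"
    by (rule continuous_on_tendsto_compose[OF _ X_y y]) (intro always_eventually allI X_in_ball)
  moreover have "(\<lambda>n. f (X n) + g (X n)) \<longlonglongrightarrow> 0"
  proof (rule Lim_null_comparison)
    show "\<forall>\<^sub>F n in sequentially. norm (f (X n) + g (X n)) \<le> W (T n)"
      using iterate_invariant by (intro always_eventually) blast
    have "(\<lambda>n. W (T n)) \<longlonglongrightarrow> W t_star"
      by (rule continuous_on_tendsto_compose[OF continuous_on_W T_LIMSEQ t_star(1)])
         (simp add: T_in_Icc always_eventually del: atLeastAtMost_iff)
    then show "(\<lambda>n. W (T n)) \<longlonglongrightarrow> 0" by (simp add: t_star(2))
  qed
  ultimately have "f y + g y = 0" by (rule LIMSEQ_unique)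
  then show ?thesis using y by blast
qed

end

theorem mainTheorem1:
  fixes D :: "'a::banach set" and x0 :: 'a
    and f g :: "'a \<Rightarrow> 'a" and f' :: "'a \<Rightarrow> 'a \<Rightarrow>\<^sub>L 'a"
    and \<omega> \<psi> :: "real \<Rightarrow> real" and h a chi t_star :: real
  assumes "convex D" and "x0 \<in> D"
    and "f' x0 = id_blinfun"
    and "\<omega> \<in> class_N"
    and "regularly_smooth_on \<omega> h f f' D"
    and "\<forall>t\<ge>0. 0 \<le> \<psi> t" and "mono_on {0..} \<psi>"
    and "\<forall>t\<ge>0. cball x0 t \<subseteq> D \<longrightarrow>
           (\<forall>x'\<in>cball x0 t. \<forall>x''\<in>cball x0 t. norm (g x'' - g x') \<le> \<psi> t * norm (x'' - x'))"
    and "0 < a" and "norm (f x0 + g x0) \<le> a"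
    and "chi = modulus_inv \<omega> (1 - h)"
    and "t_star \<in> {0..chi}" and "majorant \<omega> \<psi> a h chi t_star = 0"
    and "\<forall>t\<in>{0..chi}. majorant \<omega> \<psi> a h chi t = 0 \<longrightarrow> t = t_star"
    and "cball x0 t_star \<subseteq> D"
    and "a < primitive \<omega> chi + h * chi - primitive \<psi> chi"
  shows "\<exists>x_star.
    (let x = successive_approx f g f' x0; t = majorant_seq \<omega> \<psi> a h chi in
      (x_star \<in> cball x0 t_star \<and> f x_star + g x_star = 0 \<and>
       (\<forall>y\<in>cball x0 t_star. f y + g y = 0 \<longrightarrow> y = x_star)) \<and>
      ((\<forall>n. x n \<in> cball x0 t_star \<and> blinfun_invertible (f' (x n))) \<and>
       x \<longlonglongrightarrow> x_star) \<and>
      ((\<forall>n. norm (x (Suc n) - x n) \<le> t (Suc n) - t n \<and> norm (x_star - x n) \<le> t_star - t n) \<and>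
       strict_mono t \<and> t \<longlonglongrightarrow> t_star))"
proof -
  have h: "0 \<le> h" using assms(5) by (simp add: regularly_smooth_on_def)
  interpret majorant_setup \<omega> \<psi> a h chi t_star
    by unfold_locales (fact assms h)+
  show ?thesis
  proof (cases "\<exists>v::'a. v \<noteq> 0")
    case True
    then obtain v :: 'a where v: "v \<noteq> 0" by blast
    have norm_id: "norm (id_blinfun :: 'a \<Rightarrow>\<^sub>L 'a) = 1"
      using norm_blinfun[of "id_blinfun :: 'a \<Rightarrow>\<^sub>L 'a" v] v norm_blinfun_id_le[where 'a = 'a]
      by simp
    interpret operator_setup \<omega> \<psi> a h chi t_star D x0 f g f'
      by unfold_locales (fact assms norm_id)+
    obtain y where y: "y \<in> cball x0 t_star" "f y + g y = 0"
      using root_exists by blast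
    moreover have "z = y" if "z \<in> cball x0 t_star" "f z + g z = 0" for z
      using root_is_limit[OF that] root_is_limit[OF y] by (rule LIMSEQ_unique)
    ultimately show ?thesis
      unfolding Let_def
      using root_is_limit[OF y] root_distance[OF y] X_in_ball X_invertible X_step strict_mono_T T_LIMSEQ
      by blast
  next
    case False
    \<comment> \<open>In the zero space the identity has norm \<open>0\<close>, so \<open>1\<close> need not be a value of \<open>\<omega>\<close> and \<open>chi\<close> may be
      an arbitrary number. The scalar statements still follow from the properties of \<open>majorant\<close> on
      \<open>[0, chi]\<close>, and the statements on vectors are trivial.\<close>
    then have all: "v = w" for v w :: 'a by metis
    have inv: "blinfun_invertible A" for A :: "'a \<Rightarrow>\<^sub>L 'a"
      unfolding blinfun_invertible_def is_blinfun_inverse_def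
      by (intro exI[of _ A] conjI blinfun_eqI all)
    have ball: "v \<in> cball x0 t_star" for v
      using all[of v x0] t_star_pos by simp
    have norm_0: "norm v = 0" for v :: 'a using all[of v 0] by simp
    have X: "successive_approx f g f' x0 = (\<lambda>n. x0)" by (rule ext) (rule all)
    have root: "f x0 + g x0 = 0" by (rule all)
    have unique: "v = x0" for v by (rule all)
    have step: "norm (v - w) \<le> T (Suc n) - T n" for v w :: 'a and n
      using T_less[of n] by (simp add: norm_0)
    have dist: "norm (v - w) \<le> t_star - T n" for v w :: 'a and n
      using T_range[of n] by (simp add: norm_0)
    have lim: "successive_approx f g f' x0 \<longlonglongrightarrow> x0"
      unfolding X by (rule tendsto_const)
    show ?thesis
      unfolding Let_def using ball inv root unique step dist lim strict_mono_T T_LIMSEQ by blast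
  qed
qed

end
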